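(* Let $m\ge1$ be an integer and let $\mathsf M=(\mathsf M_{j,k})_{0\le j,k\le m-1}$ be the $m\times m$ matrix with $$\mathsf M_{j,k}=\begin{cases}2^{1+j+k-2m}\binom{2n}{n},&j,k\text{ both even},\\-2^{j+k-2m}\left[\binom{2n}{n}-\binom{2n}{n+1}\right],&j,k\text{ both odd},\\0,&j+k\text{ odd},\end{cases}$$ where $n=m-\frac{j+k}{2}-1$ in the first two cases. Then $$\det(\mathsf M)=(-1)^{\lfloor m/2\rfloor}\,2^{-m^2}.$$
   Context: Rows and columns are indexed from $0$ to $m-1$. *)

theory Defs
  imports Complex_Main "Jordan_Normal_Form.Determinant"
begin

text \<open>
  The truncated subtraction and division in \<open>n\<close> are exact in the cases that use it:
  there \<open>j + k\<close> is even and, for \<open>j, k < m\<close>, we have \<open>j + k \<le> 2 * m - 2\<close>.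
\<close>

definition M_entry :: "nat \<Rightarrow> nat \<Rightarrow> nat \<Rightarrow> real" where
  "M_entry m j k =
     (let n = m - (j + k) div 2 - 1 in
      if even j \<and> even k then
        2 powi (1 + int j + int k - 2 * int m) * real ((2 * n) choose n)
      else if odd j \<and> odd k then
        - (2 powi (int j + int k - 2 * int m)
            * (real ((2 * n) choose n) - real ((2 * n) choose (n + 1))))
      else 0)"

definition M_mat :: "nat \<Rightarrow> real mat" where
  "M_mat m = mat m m (\<lambda>(j, k). M_entry m j k)"

end

theory Submission
  imports Defs
begin

text \<open>
  The matrix is congruent to a diagonal one, and the congruence comes from two families of
  orthogonal polynomials. With \<open>p = m - 1 - j\<close> and \<open>q = m - 1 - k\<close> the index \<open>n\<close> of an entry
  equals \<open>(p + q) / 2\<close>. For even \<open>j + k\<close> the entry is therefore, up to its sign and a power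
  of 2, the moment of order \<open>p + q\<close> of a classical distribution: central binomial
  coefficients (the arcsine law, Chebyshev polynomials of the first kind) for even \<open>j, k\<close>, and Catalan
  numbers (the semicircle law, Chebyshev polynomials of the second kind) for odd \<open>j, k\<close>.
  In both cases the moment counts weighted nearest-neighbour walks on
  \<open>\<nat>\<close> of length \<open>p + q\<close> from 0 to 0. The step operator is self-adjoint for a diagonal weight,
  so such a walk can be cut after \<open>p\<close> steps (\<open>sum_walks_mult\<close>); this writes the moment of order
  \<open>p + q\<close> as a weighted scalar product of the vectors counting walks of lengths \<open>p\<close> and \<open>q\<close>.

  A walk of length \<open>p\<close> ends at a height at most \<open>p\<close> and of the parity of \<open>p\<close>. The bound makes
  the matrix of walk counts triangular with unit diagonal. The parity lets the two families be
  interleaved, one on the even and one on the odd indices: contributions of mixed parity vanish,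
  as do the entries of the matrix with \<open>j + k\<close> odd. The result is a factorization
  \<open>M = U D U\<^sup>T\<close> (\<open>M_mat_factorization\<close>) with \<open>U\<close> upper triangular and \<open>D\<close> diagonal, and the
  determinant is a product of diagonal entries.
\<close>

section \<open>Weighted walks on the half-line\<close>

text \<open>
  \<open>walks c p d\<close> counts the walks of length \<open>p\<close> on \<open>\<nat>\<close> from 0 to \<open>d\<close> with steps of size 1, where
  each step from 1 down to 0 contributes a factor \<open>c\<close>. For \<open>c = 1\<close> these are the ballot
  numbers. For \<open>c = 2\<close> they count walks on \<open>\<int>\<close> that end at \<open>d\<close>, since a step to 0 in absolute
  value can come from either side.
\<close>

fun walks :: "'a::comm_ring_1 \<Rightarrow> nat \<Rightarrow> nat \<Rightarrow> 'a" where
  "walks c 0 d = (if d = 0 then 1 else 0)"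
| "walks c (Suc p) 0 = c * walks c p 1"
| "walks c (Suc p) (Suc d) = walks c p d + walks c p (Suc (Suc d))"

definition walk_weight :: "'a::comm_ring_1 \<Rightarrow> nat \<Rightarrow> 'a" where
  "walk_weight c d = (if d = 0 then 1 else c)"

lemma walks_eq_0_if_gt: "p < d \<Longrightarrow> walks c p d = 0"
proof (induction c p d rule: walks.induct)
qed auto

lemma walks_eq_0_if_odd: "odd (p + d) \<Longrightarrow> walks c p d = 0"
proof (induction c p d rule: walks.induct)
qed (auto elim: oddE)

lemma walks_diag: "walks c p p = 1"
  by (induction p) (auto simp: walks_eq_0_if_gt)

text \<open>
  The step operator is self-adjoint for the scalar product with weights \<open>walk_weight c\<close>: both
  sides equal \<open>c\<close> times the sum over the edges \<open>{d, d + 1}\<close> of the products of a value at one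
  end of the edge with a value at the other. The range of summation must contain both supports.
\<close>

lemma sum_walks_shift:
  assumes "p + 1 < N" "q + 1 < N"
  shows "(\<Sum>d<N. walk_weight c d * walks c (Suc p) d * walks c q d)
       = (\<Sum>d<N. walk_weight c d * walks c p d * walks c (Suc q) d)"
proof -
  have edges: "(\<Sum>d<N. walk_weight c d * walks c (Suc p) d * walks c q d)
      = c * (\<Sum>d<N. walks c p (Suc d) * walks c q d + walks c p d * walks c q (Suc d))"
    if pq: "p + 1 < N" "q + 1 < N" for p q
  proof -
    obtain K where K: "N = Suc K" using pq by (cases N) auto
    have top: "walks c p (Suc K) = 0" "walks c q (Suc K) = 0" "walks c p K = 0"
      using pq K by (auto intro: walks_eq_0_if_gt)
    have "(\<Sum>d<N. walk_weight c d * walks c (Suc p) d * walks c q d)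
        = c * (walks c p 1 * walks c q 0
            + (\<Sum>d<K. walks c p (Suc (Suc d)) * walks c q (Suc d))
            + (\<Sum>d<K. walks c p d * walks c q (Suc d)))"
      unfolding K sum.lessThan_Suc_shift
      by (simp add: walk_weight_def algebra_simps sum.distrib sum_distrib_left)
    also have "walks c p 1 * walks c q 0 + (\<Sum>d<K. walks c p (Suc (Suc d)) * walks c q (Suc d))
        = (\<Sum>d<N. walks c p (Suc d) * walks c q d)"
      unfolding K sum.lessThan_Suc_shift by simp
    also have "(\<Sum>d<K. walks c p d * walks c q (Suc d)) = (\<Sum>d<N. walks c p d * walks c q (Suc d))"
      unfolding K using top by simp
    finally show ?thesis by (simp add: sum.distrib)
  qed
  have "(\<Sum>d<N. walk_weight c d * walks c p d * walks c (Suc q) d)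
      = (\<Sum>d<N. walk_weight c d * walks c (Suc q) d * walks c p d)"
    by (simp add: mult_ac)
  then show ?thesis
    using edges[OF assms] edges[OF assms(2,1)] by (simp add: add.commute mult.commute)
qed

text \<open>Moving all steps to one factor leaves \<open>walks c 0\<close> in the other, which picks out \<open>d = 0\<close>.\<close>

lemma sum_walks_mult:
  assumes "p < N" "q < N"
  shows "(\<Sum>d<N. walk_weight c d * walks c p d * walks c q d) = walks c (p + q) 0"
proof -
  \<comment> \<open>The other factor may grow to length \<open>p + q\<close>, so the identity is first proved on a longer range.\<close>
  have long: "(\<Sum>d<p + q + 2. walk_weight c d * walks c p d * walks c q d) = walks c (p + q) 0" for p q
  proof (induction p arbitrary: q)
    case 0
    have "(\<Sum>d<0 + q + 2. walk_weight c d * walks c 0 d * walks c q d)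
        = (\<Sum>d<q + 2. if d = 0 then walks c q d else 0)"
      by (intro sum.cong) (auto simp: walk_weight_def)
    then show ?case by simp
  next
    case (Suc p)
    show ?case
      using sum_walks_shift[of p "Suc p + q + 2" q c] Suc.IH[of "Suc q"] by simp
  qed
  have "(\<Sum>d<N. walk_weight c d * walks c p d * walks c q d)
      = (\<Sum>d<N + (p + q + 2). walk_weight c d * walks c p d * walks c q d)"
    using assms by (intro sum.mono_neutral_left) (auto simp: walks_eq_0_if_gt)
  also have "\<dots> = (\<Sum>d<p + q + 2. walk_weight c d * walks c p d * walks c q d)"
    by (intro sum.mono_neutral_right) (auto simp: walks_eq_0_if_gt)
  finally show ?thesis using long by simp
qed

lemma walks_2_eq_binomial:
  "walks (2::'a::comm_ring_1) (d + 2 * h) d = of_nat ((d + 2 * h) choose (d + h))"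
proof (induction "d + 2 * h" arbitrary: d h)
  case 0
  then show ?case by simp
next
  case (Suc p)
  show ?case
  proof (cases d)
    case 0
    then obtain i where h: "h = Suc i" and p: "p = 1 + 2 * i"
      using Suc.hyps(2) by (cases h) auto
    have sym: "(2 * i + 1) choose i = (2 * i + 1) choose (i + 1)"
      using binomial_symmetric[of i "2 * i + 1"] by simp
    have "walks (2::'a) (d + 2 * h) d = 2 * of_nat (p choose (1 + i))"
      using Suc.hyps(1)[OF p] 0 p h by simp
    also have "\<dots> = of_nat ((d + 2 * h) choose (d + h))"
      using sym p h 0 by simp
    finally show ?thesis .
  next
    case d: (Suc e)
    have p: "p = e + 2 * h" using Suc.hyps(2) d by simp
    have up: "walks (2::'a) p (Suc (Suc e)) = of_nat (p choose Suc (e + h))"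
    proof (cases h)
      case 0
      then show ?thesis using p by (simp add: walks_eq_0_if_gt binomial_eq_0)
    next
      case (Suc i)
      then show ?thesis using Suc.hyps(1)[of "Suc (Suc e)" i] p by simp
    qed
    show ?thesis
      using Suc.hyps(1)[OF p] up d p by simp
  qed
qed

text \<open>
  The reflection principle: the walks on \<open>\<int>\<close> to \<open>d\<close> that visit \<open>-1\<close> are reflected there into
  the walks to \<open>-(d + 2)\<close>, which are as many as those to \<open>d + 2\<close>.
\<close>

lemma walks_1_eq_diff:
  "walks (1::'a::comm_ring_1) p d = walks 2 p d - walks 2 p (Suc (Suc d))"
proof (induction p arbitrary: d)
  case 0
  then show ?case by simp
next
  case (Suc p)
  then show ?case by (cases d) (simp_all add: algebra_simps)
qed

lemma walks_2_return: "walks (2::'a::comm_ring_1) (2 * n) 0 = of_nat ((2 * n) choose n)"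
  using walks_2_eq_binomial[of 0 n] by simp

lemma walks_1_return:
  "walks (1::'a::comm_ring_1) (2 * n) 0
     = of_nat ((2 * n) choose n) - of_nat ((2 * n) choose (n + 1))"
proof -
  have "walks (2::'a) (2 * n) 2 = of_nat ((2 * n) choose (n + 1))"
  proof (cases n)
    case 0
    then show ?thesis by simp
  next
    case (Suc i)
    then show ?thesis using walks_2_eq_binomial[of 2 i] by simp
  qed
  then show ?thesis by (simp add: walks_1_eq_diff walks_2_return flip: numeral_2_eq_2)
qed

section \<open>The triangular factorization\<close>

text \<open>Even indices use the walks with central binomial moments, odd ones those with Catalan moments.\<close>

definition parity_param :: "nat \<Rightarrow> real" where
  "parity_param j = (if even j then 2 else 1)"

text \<open>
  By length and end point the walk counts form a lower triangular array. Longer walks belong to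
  smaller row indices of \<open>M\<close>, so both indices are reversed, which makes \<open>U\<close> upper triangular.
  The powers of 2 come from splitting \<open>2\<^bsup>j + k - 2m\<^esup>\<close> over rows and columns; what is left of the sign and of the
  extra factor 2 goes into the diagonal. For \<open>j + d\<close> odd the entry of \<open>U\<close> is 0, so a diagonal
  entry only has to fit the rows of its own parity.
\<close>

definition U_entry :: "nat \<Rightarrow> nat \<Rightarrow> nat \<Rightarrow> real" where
  "U_entry m j d = (1 / 2) ^ (m - j) * walks (parity_param j) (m - 1 - j) (m - 1 - d)"

definition D_entry :: "nat \<Rightarrow> nat \<Rightarrow> real" where
  "D_entry m d = (if even d then 2 else - 1) * walk_weight (parity_param d) (m - 1 - d)"

lemma U_entry_eq_0_if_odd:
  assumes "odd (j + d)" "j < m" "d < m"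
  shows "U_entry m j d = 0"
proof -
  have "m - 1 - j + (m - 1 - d) + (j + d) = 2 * (m - 1)" using assms by simp
  then have "odd (m - 1 - j + (m - 1 - d))"
    using assms(1) by (metis even_add even_mult_iff even_numeral)
  then show ?thesis unfolding U_entry_def by (subst walks_eq_0_if_odd) auto
qed

lemma M_entry_eq_sum:
  assumes j: "j < m" and k: "k < m"
  shows "M_entry m j k = (\<Sum>d<m. U_entry m j d * D_entry m d * U_entry m k d)"
proof (cases "even (j + k)")
  case False
  have "U_entry m j d * D_entry m d * U_entry m k d = 0" if "d < m" for d
    using U_entry_eq_0_if_odd[of j d m] U_entry_eq_0_if_odd[of k d m] j k that False by auto
  then have "(\<Sum>d<m. U_entry m j d * D_entry m d * U_entry m k d) = 0"
    by (intro sum.neutral) simp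
  then show ?thesis
    using False by (auto simp: M_entry_def Let_def)
next
  case True
  define p q n where pqn: "p = m - 1 - j" "q = m - 1 - k" "n = m - (j + k) div 2 - 1"
  define c s :: real where cs: "c = parity_param j" "s = (if even j then 2 else - 1)"
  have ck: "parity_param k = c" using True cs by (auto simp: parity_param_def)
  have "2 * ((j + k) div 2) = j + k" using True by simp
  then have pq: "p + q = 2 * n" using j k pqn by arith
  have "U_entry m j d * D_entry m d * U_entry m k d
      = (1 / 2) ^ (m - j) * (1 / 2) ^ (m - k) * s
        * (walk_weight c (m - 1 - d) * walks c p (m - 1 - d) * walks c q (m - 1 - d))"
    if "d < m" for d
  proof (cases "even (j + d)")
    case False
    then have "U_entry m j d = 0" using j that U_entry_eq_0_if_odd by blast
    moreover from this have "walks c p (m - 1 - d) = 0" by (simp add: U_entry_def pqn cs)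
    ultimately show ?thesis by simp
  next
    case ev: True
    then have "D_entry m d = s * walk_weight c (m - 1 - d)"
      by (auto simp: D_entry_def cs parity_param_def)
    then show ?thesis by (simp add: U_entry_def ck pqn flip: cs)
  qed
  then have "(\<Sum>d<m. U_entry m j d * D_entry m d * U_entry m k d)
      = (1 / 2) ^ (m - j) * (1 / 2) ^ (m - k) * s
        * (\<Sum>d<m. walk_weight c (m - 1 - d) * walks c p (m - 1 - d) * walks c q (m - 1 - d))"
    by (simp add: sum_distrib_left)
  also have "(\<Sum>d<m. walk_weight c (m - 1 - d) * walks c p (m - 1 - d) * walks c q (m - 1 - d))
      = (\<Sum>d<m. walk_weight c d * walks c p d * walks c q d)"
    using sum.nat_diff_reindex[of "\<lambda>d. walk_weight c d * walks c p d * walks c q d" m] by simp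
  also have "\<dots> = walks c (2 * n) 0"
    using sum_walks_mult[of p m q c] j k pqn pq by simp
  also have "(1 / 2) ^ (m - j) * (1 / 2) ^ (m - k) = (2::real) powi (int j + int k - 2 * int m)"
  proof -
    have "int j + int k - 2 * int m = - int ((m - j) + (m - k))" using j k by simp
    then show ?thesis
      unfolding power_add[symmetric]
      by (simp only: power_int_minus power_int_of_nat power_one_over inverse_eq_divide)
  qed
  finally have *: "(\<Sum>d<m. U_entry m j d * D_entry m d * U_entry m k d)
      = 2 powi (int j + int k - 2 * int m) * s * walks c (2 * n) 0" .
  have "(2::real) powi (1 + int j + int k - 2 * int m) = 2 powi (int j + int k - 2 * int m) * 2"
    using power_int_add_1[of "2::real" "int j + int k - 2 * int m"] by (simp add: algebra_simps)
  then show ?thesis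
    using True unfolding * M_entry_def Let_def pqn(3)[symmetric]
    by (auto simp: cs parity_param_def walks_1_return walks_2_return)
qed

definition U_mat :: "nat \<Rightarrow> real mat" where
  "U_mat m = mat m m (\<lambda>(j, d). U_entry m j d)"

definition D_mat :: "nat \<Rightarrow> real mat" where
  "D_mat m = mat m m (\<lambda>(j, d). if j = d then D_entry m d else 0)"

lemma M_mat_factorization: "M_mat m = U_mat m * D_mat m * transpose_mat (U_mat m)"
proof (rule eq_matI)
  fix j k
  assume "j < dim_row (U_mat m * D_mat m * transpose_mat (U_mat m))"
    and "k < dim_col (U_mat m * D_mat m * transpose_mat (U_mat m))"
  then have j: "j < m" and k: "k < m" by (auto simp: U_mat_def)
  have UD: "(U_mat m * D_mat m) $$ (j, d) = U_entry m j d * D_entry m d" if "d < m" for d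
  proof -
    have "(U_mat m * D_mat m) $$ (j, d)
        = (\<Sum>i<m. U_entry m j i * (if i = d then D_entry m d else 0))"
      using j that by (simp add: U_mat_def D_mat_def scalar_prod_def atLeast0LessThan)
    also have "\<dots> = (\<Sum>i<m. if i = d then U_entry m j i * D_entry m d else 0)"
      by (intro sum.cong) auto
    finally show ?thesis using that by simp
  qed
  have "(U_mat m * D_mat m * transpose_mat (U_mat m)) $$ (j, k)
      = (\<Sum>d<m. (U_mat m * D_mat m) $$ (j, d) * U_mat m $$ (k, d))"
    using j k by (simp add: U_mat_def D_mat_def scalar_prod_def atLeast0LessThan)
  also have "\<dots> = M_entry m j k"
    using UD j k by (simp add: M_entry_eq_sum U_mat_def)
  finally show "M_mat m $$ (j, k) = (U_mat m * D_mat m * transpose_mat (U_mat m)) $$ (j, k)"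
    using j k by (simp add: M_mat_def)
qed (auto simp: M_mat_def U_mat_def)

section \<open>The determinants of the factors\<close>

lemma det_mat_upper_triangular:
  fixes f :: "nat \<Rightarrow> nat \<Rightarrow> 'a::comm_ring_1"
  assumes "\<And>i j. j < i \<Longrightarrow> i < n \<Longrightarrow> f i j = 0"
  shows "det (mat n n (\<lambda>(i, j). f i j)) = (\<Prod>i<n. f i i)"
proof -
  have "upper_triangular (mat n n (\<lambda>(i, j). f i j))"
    using assms by auto
  then have "det (mat n n (\<lambda>(i, j). f i j)) = prod_list (diag_mat (mat n n (\<lambda>(i, j). f i j)))"
    by (rule det_upper_triangular[of _ n]) simp
  then show ?thesis
    by (simp add: prod_list_diag_prod atLeast0LessThan)
qed

lemma det_U_mat: "det (U_mat m) = (\<Prod>i<m. (1 / 2) ^ Suc i)"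
proof -
  have "det (U_mat m) = (\<Prod>j<m. U_entry m j j)"
    unfolding U_mat_def
    by (rule det_mat_upper_triangular) (auto simp: U_entry_def intro!: walks_eq_0_if_gt)
  also have "\<dots> = (\<Prod>j<m. (1 / 2) ^ Suc (m - Suc j))"
    by (intro prod.cong) (auto simp: U_entry_def walks_diag Suc_diff_Suc simp del: power_Suc)
  also have "\<dots> = (\<Prod>i<m. (1 / 2) ^ Suc i)"
    by (rule prod.nat_diff_reindex)
  finally show ?thesis .
qed

lemma prod_alternating_4_neg1:
  "(\<Prod>d<k. if even d then 4 else - 1 :: real) = (- 1) ^ (k div 2) * 2 ^ (if even k then k else Suc k)"
  by (induction k) (auto elim!: evenE oddE)

lemma det_D_mat:
  assumes "m \<ge> 1"
  shows "det (D_mat m) = (- 1) ^ (m div 2) * 2 ^ m"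
proof -
  obtain k where m: "m = Suc k" using assms by (cases m) auto
  have "det (D_mat m) = (\<Prod>d<m. D_entry m d)"
    unfolding D_mat_def by (subst det_mat_upper_triangular) auto
  also have "\<dots> = (\<Prod>d<k. D_entry m d) * D_entry m k"
    unfolding m by simp
  also have "(\<Prod>d<k. D_entry m d) = (\<Prod>d<k. if even d then 4 else - 1)"
    unfolding m by (intro prod.cong) (auto simp: D_entry_def walk_weight_def parity_param_def)
  finally show ?thesis
    unfolding prod_alternating_4_neg1 m
    by (auto simp: D_entry_def walk_weight_def elim!: evenE oddE)
qed

lemma prod_half_powers: "(\<Prod>i<m. (1 / 2 :: real) ^ Suc i) ^ 2 * 2 ^ m = (1 / 2) ^ (m ^ 2)"
proof (induction m)
  case (Suc m)
  have "(\<Prod>i<Suc m. (1 / 2 :: real) ^ Suc i) ^ 2 * 2 ^ Suc m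
      = ((\<Prod>i<m. (1 / 2 :: real) ^ Suc i) ^ 2 * 2 ^ m) * (((1 / 2) ^ Suc m) ^ 2 * 2)"
    by (simp only: prod.lessThan_Suc power_mult_distrib power_Suc mult_ac)
  also have "\<dots> = (1 / 2) ^ (m ^ 2) * (1 / 2) ^ (2 * m + 1)"
  proof -
    have "((1 / 2 :: real) ^ Suc m) ^ 2 * 2 = (1 / 2) ^ (2 * m + 1)"
      by (simp add: mult_2 power_add power2_eq_square)
    then show ?thesis unfolding Suc.IH by simp
  qed
  also have "\<dots> = (1 / 2) ^ (Suc m ^ 2)"
    unfolding power_add[symmetric]
    by (rule arg_cong[where f = "(^) (1 / 2)"]) (simp add: power2_eq_square)
  finally show ?case .
qed simp

theorem proposition5p2:
  fixes m :: nat
  assumes "m \<ge> 1"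
  shows "det (M_mat m) = (- 1) ^ (m div 2) * 2 powi (- (int m ^ 2))"
proof -
  have carrier: "U_mat m \<in> carrier_mat m m" "D_mat m \<in> carrier_mat m m"
    by (auto simp: U_mat_def D_mat_def)
  then have "det (M_mat m) = det (U_mat m) * det (D_mat m) * det (U_mat m)"
    unfolding M_mat_factorization by (simp add: det_mult[of _ m] det_transpose[of _ m])
  also have "\<dots> = (- 1) ^ (m div 2) * (det (U_mat m) ^ 2 * 2 ^ m)"
    unfolding det_D_mat[OF assms] by (simp add: power2_eq_square)
  also have "det (U_mat m) ^ 2 * 2 ^ m = (1 / 2) ^ (m ^ 2)"
    unfolding det_U_mat by (rule prod_half_powers)
  also have "(1 / 2 :: real) ^ (m ^ 2) = 2 powi (- (int m ^ 2))"
    unfolding of_nat_power[symmetric]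
    by (simp only: power_int_minus power_int_of_nat power_one_over inverse_eq_divide)
  finally show ?thesis .
qed

end
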